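(* Every $aa$-representable graph (equivalently, every word-representable graph) is $aab$-representable.
   Context: Graphs are finite, simple, undirected. Two words are isomorphic if one is obtained from the other by a bijective renaming of letters. For a word $w$ and letters $x,y$, $w|_{xy}$ denotes the subword of $w$ consisting of all occurrences of $x$ and $y$ (in order). A word $u$ over letters from $\{a,b\}$ occurs in $w|_{xy}$ ($x\neq y$) if some contiguous factor of $w|_{xy}$ is isomorphic to $u$ (for $u=aa$: two equal consecutive letters; for $u=aab$: a factor of the form $zzz'$ with $\{z,z'\}=\{x,y\}$); otherwise $w|_{xy}$ avoids $u$. For a word $t$, a graph $G=(V,E)$ is $t$-representable if there is a word $w$ over the alphabet $V$ containing each letter of $V$ at least once such that for all distinct $x,y\in V$, $xy\in E$ if and only if $w|_{xy}$ avoids $t$. $aa$-representability coincides with word-representability, where $xy\in E$ iff $x$ and $y$ alternate in $w$. *)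

theory Defs
  imports "Graph_Theory.Pair_Digraph" "HOL-Library.Sublist"
begin

text \<open>
  Finite simple undirected graphs are rendered by the locale predicate \<^const>\<open>pair_graph\<close>:
  a finite vertex set \<^const>\<open>pverts\<close> with a symmetric and irreflexive edge relation
  \<^const>\<open>parcs\<close> on it, so that an edge $xy$ is present as both $(x,y)$ and $(y,x)$.
\<close>

definition word_iso :: "'a list \<Rightarrow> 'b list \<Rightarrow> bool" where
  "word_iso u v \<longleftrightarrow> (\<exists>f. bij_betw f (set u) (set v) \<and> v = map f u)"

definition restrict_word :: "'a list \<Rightarrow> 'a \<Rightarrow> 'a \<Rightarrow> 'a list" where
  "restrict_word w x y = filter (\<lambda>z. z \<in> {x, y}) w"

datatype letter = a | b

text \<open>Here \<^const>\<open>sublist\<close> is the contiguous factor relation, not the subsequence relation.\<close>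

definition pattern_occurs :: "letter list \<Rightarrow> 'a list \<Rightarrow> bool" where
  "pattern_occurs u w \<longleftrightarrow> (\<exists>v. sublist v w \<and> word_iso u v)"

definition avoids :: "'a list \<Rightarrow> letter list \<Rightarrow> bool" where
  "avoids w u \<longleftrightarrow> \<not> pattern_occurs u w"

definition pattern_representable :: "letter list \<Rightarrow> 'v pair_pre_digraph \<Rightarrow> bool" where
  "pattern_representable t G \<longleftrightarrow>
     (\<exists>w. set w = pverts G \<and>
        (\<forall>x \<in> pverts G. \<forall>y \<in> pverts G. x \<noteq> y \<longrightarrow>
           ((x, y) \<in> parcs G \<longleftrightarrow> avoids (restrict_word w x y) t)))"

text \<open>The word $xyxy\ldots$ of length \<open>n\<close>.\<close>

definition alternating_word :: "'a \<Rightarrow> 'a \<Rightarrow> nat \<Rightarrow> 'a list" where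
  "alternating_word x y n = map (\<lambda>i. if even i then x else y) [0..<n]"

definition alternate_in :: "'a \<Rightarrow> 'a \<Rightarrow> 'a list \<Rightarrow> bool" where
  "alternate_in x y w \<longleftrightarrow>
     (\<exists>n. restrict_word w x y = alternating_word x y n \<or>
          restrict_word w x y = alternating_word y x n)"

definition word_representable :: "'v pair_pre_digraph \<Rightarrow> bool" where
  "word_representable G \<longleftrightarrow>
     (\<exists>w. set w = pverts G \<and>
        (\<forall>x \<in> pverts G. \<forall>y \<in> pverts G. x \<noteq> y \<longrightarrow>
           ((x, y) \<in> parcs G \<longleftrightarrow> alternate_in x y w)))"

hide_const (open) a b

end

theory Submission
  imports Defs
begin

text \<open>
  If \<open>w\<close> represents \<open>G\<close> with respect to \<open>aa\<close>, then \<open>w @ remdups w\<close> represents \<open>G\<close> with respect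
  to \<open>aab\<close>. Here \<open>remdups w\<close> lists the letters in the order of their last occurrences in \<open>w\<close>, so a
  restriction that alternates and ends in \<open>xy\<close> is continued by \<open>xy\<close> and still alternates; and a
  factor \<open>xx\<close> of a restriction is now followed by an occurrence of the other letter.
\<close>

lemma word_iso_aa: "word_iso [letter.a, letter.a] v \<longleftrightarrow> (\<exists>z. v = [z, z])"
proof
  assume "\<exists>z. v = [z, z]"
  then obtain z where "v = [z, z]" by blast
  then show "word_iso [letter.a, letter.a] v"
    unfolding word_iso_def by (intro exI[of _ "\<lambda>_. z"]) (auto simp: bij_betw_def)
qed (auto simp: word_iso_def)

lemma word_iso_aab:
  "word_iso [letter.a, letter.a, letter.b] v \<longleftrightarrow> (\<exists>z z'. z \<noteq> z' \<and> v = [z, z, z'])"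
proof
  assume "\<exists>z z'. z \<noteq> z' \<and> v = [z, z, z']"
  then obtain z z' where "z \<noteq> z'" "v = [z, z, z']" by blast
  then show "word_iso [letter.a, letter.a, letter.b] v"
    unfolding word_iso_def
    by (intro exI[of _ "\<lambda>l. if l = letter.a then z else z'"]) (auto simp: bij_betw_def)
next
  assume "word_iso [letter.a, letter.a, letter.b] v"
  then obtain f where "inj_on f {letter.a, letter.b}" "v = map f [letter.a, letter.a, letter.b]"
    by (auto simp: word_iso_def bij_betw_def)
  then show "\<exists>z z'. z \<noteq> z' \<and> v = [z, z, z']" by (auto simp: inj_on_def)
qed

text \<open>\<open>distinct_adj\<close> serves as the common form of avoiding \<open>aa\<close> and
  of alternation, so both halves of the theorem are reduced to it.\<close>

lemma distinct_adj_iff_no_square: "distinct_adj v \<longleftrightarrow> (\<nexists>z. sublist [z, z] v)"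
proof (induction v rule: induct_list012)
  case (3 x y zs)
  then show ?case by (auto simp: sublist_Cons_right)
qed (auto simp: sublist_Cons_right)

lemma avoids_aa_iff: "avoids v [letter.a, letter.a] \<longleftrightarrow> distinct_adj v"
  by (auto simp: avoids_def pattern_occurs_def word_iso_aa distinct_adj_iff_no_square)

lemma avoids_aab_iff:
  "avoids v [letter.a, letter.a, letter.b] \<longleftrightarrow> (\<forall>z z'. sublist [z, z, z'] v \<longrightarrow> z = z')"
  by (auto simp: avoids_def pattern_occurs_def word_iso_aab)

text \<open>Every factor of shape \<open>aab\<close> starts with a square \<open>aa\<close>.\<close>

lemma distinct_adj_avoids_aab:
  assumes "distinct_adj v"
  shows "avoids v [letter.a, letter.a, letter.b]"
proof -
  have "sublist [z, z] [z, z, z']" for z z' :: 'a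
    by (auto simp: sublist_Cons_right)
  then show ?thesis
    using assms unfolding avoids_aab_iff distinct_adj_iff_no_square
    by (meson sublist_order.order.trans)
qed

text \<open>The first letter of \<open>r\<close> that differs from \<open>z\<close> ends the initial
  run of \<open>z\<close>; with the last two letters of that run it forms the factor.\<close>

lemma square_extends_to_aab:
  assumes "c \<in> set r" "c \<noteq> z"
  shows "\<exists>d. d \<noteq> z \<and> sublist [z, z, d] (z # z # r)"
  using assms
proof (induction r)
  case (Cons e r)
  show ?case
  proof (cases "e = z")
    case True
    with Cons obtain d where "d \<noteq> z" "sublist [z, z, d] (z # z # r)" by auto
    with True show ?thesis by (auto simp: sublist_Cons_right)
  next
    case False
    then show ?thesis by (intro exI[of _ e]) (auto simp: sublist_Cons_right)
  qed
qed simp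

lemma distinct_adj_append_remdups:
  assumes "set v = {x, y}" "x \<noteq> y" "distinct_adj v"
  shows "distinct_adj (v @ remdups v)"
proof -
  obtain vs q where v1: "v = vs @ [q]"
    using assms(1) by (cases v rule: rev_cases) auto
  \<comment> \<open>Both letters occur in \<open>v\<close>, so its length is at least two.\<close>
  obtain us p where "vs = us @ [p]"
    using assms(1,2) v1 by (cases vs rule: rev_cases) auto
  with v1 have v: "v = us @ [p, q]" by simp
  have "p \<noteq> q" using assms(3) v by (simp add: distinct_adj_append_iff)
  have "{p, q} \<subseteq> {x, y}" "set us \<subseteq> {x, y}"
    using assms(1) v by auto
  with \<open>p \<noteq> q\<close> have "set us \<subseteq> {p, q}" by blast
  \<comment> \<open>\<open>remdups\<close> keeps last occurrences, so each letter of
    \<open>us\<close> is dropped because it recurs in \<open>[p, q]\<close>.\<close>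
  then have "remdups (us @ [p, q]) = [p, q]"
    using \<open>p \<noteq> q\<close> by (induction us) auto
  then show ?thesis
    using assms(3) \<open>p \<noteq> q\<close> v by (auto simp: distinct_adj_append_iff)
qed

lemma append_remdups_avoids_aab_iff:
  assumes "set v = {x, y}" "x \<noteq> y"
  shows "avoids (v @ remdups v) [letter.a, letter.a, letter.b] \<longleftrightarrow> distinct_adj v"
proof
  assume "distinct_adj v"
  then show "avoids (v @ remdups v) [letter.a, letter.a, letter.b]"
    by (intro distinct_adj_avoids_aab distinct_adj_append_remdups[OF assms])
next
  assume av: "avoids (v @ remdups v) [letter.a, letter.a, letter.b]"
  show "distinct_adj v"
  proof (rule ccontr)
    assume "\<not> distinct_adj v"
    then obtain z ps qs where v: "v = ps @ [z, z] @ qs"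
      by (auto simp: distinct_adj_iff_no_square sublist_def)
    obtain c where "c \<in> set v" "c \<noteq> z" using assms by auto
    \<comment> \<open>In \<open>v\<close> itself the square may be followed by copies of
      \<open>z\<close> only; the appended \<open>remdups v\<close> has the same letters as
      \<open>v\<close> and so supplies \<open>c\<close>.\<close>
    then obtain d where "d \<noteq> z" and d: "sublist [z, z, d] (z # z # (qs @ remdups v))"
      using square_extends_to_aab[of c "qs @ remdups v" z] by auto
    have "sublist (z # z # (qs @ remdups v)) (v @ remdups v)"
      using v by (metis append.assoc append_Cons append_Nil sublist_append_leftI)
    with d have "sublist [z, z, d] (v @ remdups v)"
      by (rule sublist_order.order.trans)
    with av \<open>d \<noteq> z\<close> show False unfolding avoids_aab_iff by blast
  qed
qed

text \<open>Whether an occurrence is the last of its letter does not depend on the other letters, so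
  \<open>remdups\<close> commutes with \<open>filter\<close>. This reduces the claim to words over
  two letters.\<close>

lemma restrict_word_append_remdups:
  "restrict_word (w @ remdups w) x y = restrict_word w x y @ remdups (restrict_word w x y)"
  by (simp add: restrict_word_def remdups_filter)

lemma alternating_word_Suc: "alternating_word x y (Suc n) = x # alternating_word y x n"
proof -
  \<comment> \<open>The first index is split off, not the last as \<open>upt_Suc\<close> would do;
    shifting the others by one flips parity and so swaps \<open>x\<close> and
    \<open>y\<close>.\<close>
  have "[0..<Suc n] = 0 # map Suc [0..<n]"
    by (simp only: map_Suc_upt upt_conv_Cons[OF zero_less_Suc])
  then show ?thesis
    by (simp add: alternating_word_def comp_def del: upt_Suc)
qed

lemma distinct_adj_alternating_word:
  "x \<noteq> y \<Longrightarrow> distinct_adj (alternating_word x y n)"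
proof (induction n arbitrary: x y)
  case 0
  then show ?case by (simp add: alternating_word_def)
next
  case (Suc n)
  then have "distinct_adj (alternating_word y x n)"
    using Suc.IH[of y x] by simp
  with Suc.prems show ?case
    \<comment> \<open>The case split shows whether the tail is empty or starts with
      \<open>y\<close>, which differs from \<open>x\<close>.\<close>
    by (cases n) (simp_all add: alternating_word_Suc, simp add: alternating_word_def)
qed

text \<open>With two letters available, each letter is forced by its predecessor; the roles of
  \<open>x\<close> and \<open>y\<close> swap at every step of the induction.\<close>

lemma distinct_adj_imp_alternating_word:
  assumes "distinct_adj (x # v)" "set v \<subseteq> {x, y}"
  shows "x # v = alternating_word x y (Suc (length v))"
  using assms
proof (induction v arbitrary: x y)
  case Nil
  then show ?case by (simp add: alternating_word_def)
next
  case (Cons c v)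
  then have "c = y" by auto
  with Cons have "c # v = alternating_word y x (Suc (length v))" by auto
  then show ?case by (simp add: alternating_word_Suc)
qed

lemma alternate_in_iff:
  assumes "x \<noteq> y"
  shows "alternate_in x y w \<longleftrightarrow> distinct_adj (restrict_word w x y)"
proof
  assume "alternate_in x y w"
  then show "distinct_adj (restrict_word w x y)"
    using assms distinct_adj_alternating_word unfolding alternate_in_def by metis
next
  assume dist: "distinct_adj (restrict_word w x y)"
  have sub: "set (restrict_word w x y) \<subseteq> {x, y}" by (auto simp: restrict_word_def)
  show "alternate_in x y w"
  proof (cases "restrict_word w x y")
    case Nil
    then show ?thesis
      unfolding alternate_in_def by (intro exI[of _ 0]) (simp add: alternating_word_def)
  next
    case (Cons c v)
    with sub consider "c = x" | "c = y" by auto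
    then show ?thesis
    proof cases
      case 1
      with Cons dist sub show ?thesis
        using distinct_adj_imp_alternating_word[of x v y] unfolding alternate_in_def by auto
    next
      case 2
      with Cons dist sub show ?thesis
        using distinct_adj_imp_alternating_word[of y v x] unfolding alternate_in_def by auto
    qed
  qed
qed

lemma aa_representable_iff_word_representable:
  "pattern_representable [letter.a, letter.a] G \<longleftrightarrow> word_representable G"
  unfolding pattern_representable_def word_representable_def
  by (simp add: avoids_aa_iff alternate_in_iff cong: conj_cong)

lemma aa_representable_imp_aab_representable:
  assumes "pattern_representable [letter.a, letter.a] G"
  shows "pattern_representable [letter.a, letter.a, letter.b] G"
proof -
  obtain w where w: "set w = pverts G"
    and edge: "\<forall>x \<in> pverts G. \<forall>y \<in> pverts G. x \<noteq> y \<longrightarrow>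
      ((x, y) \<in> parcs G \<longleftrightarrow> distinct_adj (restrict_word w x y))"
    using assms unfolding pattern_representable_def avoids_aa_iff by blast
  have "(x, y) \<in> parcs G \<longleftrightarrow>
      avoids (restrict_word (w @ remdups w) x y) [letter.a, letter.a, letter.b]"
    if "x \<in> pverts G" "y \<in> pverts G" "x \<noteq> y" for x y
  proof -
    \<comment> \<open>Every vertex occurs in \<open>w\<close>, so both letters are present and any
      square has another letter available to complete \<open>aab\<close>.\<close>
    have "set (restrict_word w x y) = {x, y}"
      using that w by (auto simp: restrict_word_def)
    with that edge show ?thesis
      by (simp add: restrict_word_append_remdups append_remdups_avoids_aab_iff)
  qed
  then show ?thesis
    unfolding pattern_representable_def by (intro exI[of _ "w @ remdups w"]) (simp add: w)
qed

theorem theorem10: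
  fixes G :: "'v pair_pre_digraph"
  assumes "pair_graph G"
  shows "(pattern_representable [letter.a, letter.a] G \<longrightarrow>
            pattern_representable [letter.a, letter.a, letter.b] G) \<and>
         (pattern_representable [letter.a, letter.a] G \<longleftrightarrow> word_representable G)"
  using aa_representable_imp_aab_representable aa_representable_iff_word_representable by blast

end
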